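(* For every $k \in \{4,5,6,7,8\}$, $k+2$ distinct symbols suffice to construct a $k$-Thue sequence of any length; that is, if $\mathbb{A}$ is an alphabet with exactly $k+2$ symbols, then for every positive integer $n$ there exists a $k$-Thue sequence of length $n$ all of whose terms belong to $\mathbb{A}$.
   Context: A sequence of length $n$ over an alphabet $\mathbb{A}$ is an ordered tuple $x_1 x_2\dots x_n$ of symbols of $\mathbb{A}$. A repetition in a sequence is a block of consecutive terms $y_1\dots y_{2t}$ ($t \ge 1$) such that $y_i = y_{t+i}$ for every $i = 1,\dots,t$. A sequence is Thue (or non-repetitive) if it contains no repetition. For a positive integer $d$, a $d$-subsequence of a sequence $x_1\dots x_n$ is an arithmetic subsequence $x_i x_{i+d} x_{i+2d}\dots$, where $1 \le i \le n$. For a positive integer $k$, a sequence is $k$-Thue if every one of its $d$-subsequences is Thue, for every $d$ with $1 \le d \le k$. *)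

theory Defs
  imports Main "HOL-Library.Sublist"
begin

definition repetition :: "'a list \<Rightarrow> bool" where
  "repetition ys \<longleftrightarrow> (\<exists>t\<ge>1. length ys = 2 * t \<and> (\<forall>i<t. ys ! i = ys ! (t + i)))"

text \<open>Here \<^const>\<open>sublist\<close> is the contiguous-block relation, not the subsequence relation.\<close>

definition thue :: "'a list \<Rightarrow> bool" where
  "thue xs \<longleftrightarrow> \<not> (\<exists>ys. sublist ys xs \<and> repetition ys)"

text \<open>
  The subsequence at positions i, i + d, i + 2d, ..., continued up to the end of the list.
  Positions are counted from 0, so the starting positions 1, ..., n of a sequence of
  length n become i < n.
\<close>

definition d_subsequence :: "nat \<Rightarrow> nat \<Rightarrow> 'a list \<Rightarrow> 'a list" where
  "d_subsequence d i xs = nths xs {i + j * d |j. True}"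

definition k_thue :: "nat \<Rightarrow> 'a list \<Rightarrow> bool" where
  "k_thue k xs \<longleftrightarrow>
     (\<forall>d i. 1 \<le> d \<and> d \<le> k \<and> i < length xs \<longrightarrow> thue (d_subsequence d i xs))"

end

theory Submission
  imports Defs "HOL-Number_Theory.Cong"
begin

text \<open>
  Let \<open>w\<close> be an infinite square-free word over \<open>{-1, 0, 1}\<close> (first differences of the Thue-Morse
  word) and replace every letter \<open>z\<close> of \<open>w\<close> by a word \<open>h z\<close> of length \<open>m\<close> over \<open>k + 2\<close> letters,
  where \<open>m\<close> is coprime to every \<open>d \<le> k\<close>. Suppose the image has a square in a progression of
  difference \<open>d\<close> with \<open>t\<close> terms in each half. If \<open>m\<close> divides \<open>t\<close>, the two halves are a whole
  number of blocks apart and compare equal positions of blocks; every residue class modulo \<open>d\<close>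
  contains a pivot, i.e. a position at which the three words \<open>h z\<close> differ pairwise, so \<open>w\<close>
  itself has a square. If \<open>m\<close> does not divide \<open>t\<close>, the two halves are misaligned and some pair of
  compared positions carries different letters whatever \<open>w\<close> is, by a finite check on
  the three words \<open>h z\<close>. These words were found with a SAT solver.
\<close>

subsection \<open>A square-free word over three letters\<close>

text \<open>Integer values keep the first differences taken below from being truncated.\<close>

fun thue_morse :: "nat \<Rightarrow> int" where
  "thue_morse n =
     (if n = 0 then 0 else if even n then thue_morse (n div 2) else 1 - thue_morse (n div 2))"

declare thue_morse.simps [simp del]

lemma thue_morse_even [simp]: "thue_morse (2 * n) = thue_morse n"
  by (cases "n = 0") (simp_all add: thue_morse.simps[of "2 * n"])

lemma thue_morse_odd [simp]: "thue_morse (Suc (2 * n)) = 1 - thue_morse n"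
  by (simp add: thue_morse.simps[of "Suc (2 * n)"])

lemma thue_morse_range: "thue_morse n \<in> {0, 1}"
proof (induction n rule: less_induct)
  case (less n)
  show ?case
  proof (cases "n = 0")
    case False
    then have "thue_morse (n div 2) \<in> {0, 1}" by (intro less) simp
    with False show ?thesis by (auto simp: thue_morse.simps[of n])
  qed (simp add: thue_morse.simps[of 0])
qed

lemma thue_morse_neq_iff:
  "thue_morse a \<noteq> thue_morse b \<longleftrightarrow> thue_morse b = 1 - thue_morse a"
proof -
  have "x \<noteq> y \<longleftrightarrow> y = 1 - x" if "x \<in> {0, 1}" "y \<in> {0, 1}" for x y :: int
    using that by auto
  from this[OF thue_morse_range thue_morse_range] show ?thesis .
qed

lemma thue_morse_Suc_even:
  assumes "even n"
  shows "thue_morse (Suc n) \<noteq> thue_morse n"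
proof -
  have "1 - x \<noteq> x" for x :: int by presburger
  with assms show ?thesis by (metis evenE thue_morse_even thue_morse_odd)
qed

text \<open>One of \<open>i\<close> and \<open>Suc i\<close> is even, and an even position differs
  from its successor.\<close>

lemma thue_morse_no_cube:
  "\<not> (thue_morse i = thue_morse (Suc i) \<and> thue_morse (Suc i) = thue_morse (Suc (Suc i)))"
  using thue_morse_Suc_even[of i] thue_morse_Suc_even[of "Suc i"] by (cases "even i") auto

text \<open>Descent on the period. An even period is halved by keeping every second letter. Under an
  odd period each position has a copy of opposite parity, so the letters alternate throughout, which
  yields a cube.\<close>

lemma thue_morse_overlap_free:
  "p > 0 \<Longrightarrow> \<exists>j\<le>p. thue_morse (i + j) \<noteq> thue_morse (i + p + j)"
proof (induction p arbitrary: i rule: less_induct)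
  case (less p)
  show ?case
  proof (rule ccontr)
    assume "\<not> ?thesis"
    then have overlap: "thue_morse (i + j) = thue_morse (i + p + j)" if "j \<le> p" for j
      using that by blast
    show False
    proof (cases "even p")
      case True
      then obtain q where q: "p = 2 * q" by (elim evenE)
      with less.prems have "q < p" "q > 0" by auto
      from less.IH[OF this, of "i div 2"] obtain j
        where j: "j \<le> q" "thue_morse (i div 2 + j) \<noteq> thue_morse (i div 2 + q + j)" by blast
      show False
      proof (cases "even i")
        case True
        then have "i + 2 * j = 2 * (i div 2 + j)" "i + p + 2 * j = 2 * (i div 2 + q + j)"
          using q by auto
        with overlap[of "2 * j"] j q show False by (metis mult_le_mono2 thue_morse_even)
      next
        case False
        then have "i + 2 * j = Suc (2 * (i div 2 + j))"
          "i + p + 2 * j = Suc (2 * (i div 2 + q + j))"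
          using q by (auto elim!: oddE)
        with overlap[of "2 * j"] j(1) q
        have "1 - thue_morse (i div 2 + j) = 1 - thue_morse (i div 2 + q + j)"
          by (metis mult_le_mono2 thue_morse_odd)
        with j(2) show False by simp
      qed
    next
      case odd: False
      have alt1: "thue_morse (Suc (i + j)) \<noteq> thue_morse (i + j)" if "j < p" for j
      proof (cases "even (i + j)")
        case False
        with odd have "even (i + p + j)" by auto
        from thue_morse_Suc_even[OF this] overlap[of j] overlap[of "Suc j"] that
        show ?thesis by simp
      qed (rule thue_morse_Suc_even)
      have alt: "thue_morse (Suc (i + j)) \<noteq> thue_morse (i + j)" if "j < 2 * p" for j
      proof (cases "j < p")
        case False
        with that have "j - p < p" by auto
        from alt1[OF this] overlap[of "j - p"] overlap[of "Suc (j - p)"] False \<open>j - p < p\<close>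
        show ?thesis by simp
      qed (rule alt1)
      have alternate: "thue_morse (Suc (i + j)) = 1 - thue_morse (i + j)" if "j < 2 * p" for j
        using alt[OF that] thue_morse_neq_iff by metis
      have step: "thue_morse (Suc (Suc (i + j))) = thue_morse (i + j)" if "Suc j < 2 * p" for j
        using alternate[of j] alternate[of "Suc j"] that by simp
      show False
      proof (cases "p = 1")
        case True
        with overlap[of 0] overlap[of 1] thue_morse_no_cube[of i] show False by simp
      next
        case False
        with odd have p: "p \<ge> 3" using less.prems by presburger
        \<comment> \<open>The first even position from \<open>i\<close> on is \<open>2 * n\<close>.
          Alternation makes the letters at \<open>2 * n\<close>, \<open>2 * n + 2\<close> and
          \<open>2 * n + 4\<close> equal, a cube at \<open>n\<close>. For period 1 the
          \<open>2 * p\<close> alternating steps do not reach that far.\<close>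
        define n where "n = (i + 1) div 2"
        obtain j where j: "j \<le> 1" "i + j = 2 * n"
          unfolding n_def by (cases "even i") (auto elim!: evenE oddE intro: that[of 0] that[of 1])
        have "thue_morse (2 * (n + 1)) = thue_morse (2 * n)"
          using step[of j] j p by simp
        moreover have "thue_morse (2 * (n + 2)) = thue_morse (2 * (n + 1))"
          using step[of "j + 2"] j p by (simp add: algebra_simps)
        ultimately show False
          using thue_morse_no_cube[of n] by (simp only: thue_morse_even) simp
      qed
    qed
  qed
qed

text \<open>Known as the ternary Thue-Morse word, or the variant of Thue-Morse.\<close>

definition vtm :: "nat \<Rightarrow> int" where
  "vtm n = thue_morse (Suc n) - thue_morse n"

lemma vtm_range: "vtm n \<in> {-1, 0, 1}"
proof -
  have "y - x \<in> {-1, 0, 1}" if "x \<in> {0, 1}" "y \<in> {0, 1}" for x y :: int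
    using that by auto
  from this[OF thue_morse_range thue_morse_range] show ?thesis unfolding vtm_def .
qed

text \<open>
  Summing the differences over a square shows that \<^term>\<open>thue_morse\<close> has an arithmetic
  progression of length three at \<open>i, i + p, i + 2p\<close>; being 0-1-valued, it is constant
  there, so the square in the differences is an overlap of \<^term>\<open>thue_morse\<close>.
\<close>

lemma vtm_square_free:
  assumes "p > 0"
  shows "\<exists>j<p. vtm (i + j) \<noteq> vtm (i + p + j)"
proof (rule ccontr)
  assume "\<not> ?thesis"
  then have eq: "vtm (i + j) = vtm (i + p + j)" if "j < p" for j
    using that by blast
  have diff: "thue_morse (i + j) - thue_morse i = thue_morse (i + p + j) - thue_morse (i + p)"
    if "j \<le> p" for j
    using that
  proof (induction j)
    case (Suc j)
    then have "thue_morse (i + j) - thue_morse i = thue_morse (i + p + j) - thue_morse (i + p)"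
      by simp
    moreover have "vtm (i + j) = vtm (i + p + j)" using Suc.prems by (intro eq) simp
    ultimately show ?case unfolding vtm_def add_Suc_right by linarith
  qed simp
  have "thue_morse (i + p) = thue_morse i"
  proof -
    have "b = a" if "b - a = c - b" "a \<in> {0, 1}" "b \<in> {0, 1}" "c \<in> {0, 1}" for a b c :: int
      using that by auto
    from this[OF diff[OF order_refl] thue_morse_range thue_morse_range thue_morse_range]
    show ?thesis .
  qed
  then have "thue_morse (i + j) = thue_morse (i + p + j)" if "j \<le> p" for j
    using diff[OF that] by linarith
  with thue_morse_overlap_free[OF assms, of i] show False by blast
qed

subsection \<open>Uniform images of the square-free word\<close>

text \<open>The morphism is stored transposed: a column holds the letters of all three block words
  at one position, so two positions can be compared for all letters of the square-free word at
  once.\<close>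

type_synonym column = "nat \<times> nat \<times> nat"

fun entry :: "int \<Rightarrow> column \<Rightarrow> nat" where
  "entry z (a, b, c) = (if z = -1 then a else if z = 0 then b else c)"

definition blow_up :: "column list \<Rightarrow> nat \<Rightarrow> nat" where
  "blow_up W n = entry (vtm (n div length W)) (W ! (n mod length W))"

lemma blow_up_block:
  "p < length W \<Longrightarrow> blow_up W (b * length W + p) = entry (vtm b) (W ! p)"
  by (cases "W = []") (simp_all add: blow_up_def)

lemma vtm_Suc_neq: "vtm (Suc n) \<noteq> vtm n"
  using vtm_square_free[of 1 n] by auto

section \<open>Misaligned halves: mismatches forced by the block words\<close>

fun separated_equal :: "column \<Rightarrow> column \<Rightarrow> bool" where
  "separated_equal (a, b, c) (a', b', c') =
     (if a = a' then False else if b = b' then False else if c = c' then False else True)"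

fun separated_distinct :: "column \<Rightarrow> column \<Rightarrow> bool" where
  "separated_distinct (a, b, c) (a', b', c') =
     (if a = b' then False else if a = c' then False else
      if b = a' then False else if b = c' then False else
      if c = a' then False else if c = b' then False else True)"

definition separated :: "column \<Rightarrow> column \<Rightarrow> bool" where
  "separated x y \<longleftrightarrow> (if separated_equal x y then separated_distinct x y else False)"

lemma separated_equalD: "separated_equal x y \<Longrightarrow> entry z x \<noteq> entry z y"
  by (cases x; cases y) (auto split: if_splits)

lemma separated_distinctD:
  "separated_distinct x y \<Longrightarrow> z \<noteq> z' \<Longrightarrow> z \<in> {-1, 0, 1} \<Longrightarrow> z' \<in> {-1, 0, 1} \<Longrightarrow>
     entry z x \<noteq> entry z' y"
  by (cases x; cases y) (auto split: if_splits)

lemma separatedD: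
  "separated x y \<Longrightarrow> z \<in> {-1, 0, 1} \<Longrightarrow> z' \<in> {-1, 0, 1} \<Longrightarrow> entry z x \<noteq> entry z' y"
  using separated_equalD separated_distinctD by (metis separated_def)

lemma mod_step:
  fixes p d m :: nat
  assumes "p < m" "d < m"
  shows "(if p + d < m then p + d else p + d - m) = (p + d) mod m"
  using assms by (simp add: mod_if le_mod_geq)

text \<open>
  The letters at positions \<open>n\<close> and \<open>n + e\<close>, where \<open>p = n mod m\<close> and \<open>s = e mod m\<close>, differ whatever
  the underlying square-free word is. Positions in the same block share their letter of that word,
  positions in adjacent blocks have distinct ones, and nothing is known about other blocks.
\<close>

definition mismatch :: "column list \<Rightarrow> nat \<Rightarrow> nat \<Rightarrow> nat \<Rightarrow> nat \<Rightarrow> bool" where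
  "mismatch W m e s p \<longleftrightarrow>
     (if p + e < m then separated_equal (W ! p) (W ! (p + e))
      else if p + e < 2 * m then separated_distinct (W ! p) (W ! (p + e - m))
      else separated (W ! p) (W ! (if p + s < m then p + s else p + s - m)))"

lemma mismatchD:
  assumes "mismatch W m e (e mod m) (n mod m)" and m: "m = length W" "m > 0"
  shows "blow_up W n \<noteq> blow_up W (n + e)"
proof -
  define b p where "b = n div m" and "p = n mod m"
  have n: "n = b * m + p" and p: "p < m" using m by (simp_all add: b_def p_def)
  have n_eq: "blow_up W n = entry (vtm b) (W ! p)"
    using blow_up_block[of p W b] p m n by simp
  consider (same) "p + e < m" | (adjacent) "m \<le> p + e" "p + e < 2 * m" | (far) "2 * m \<le> p + e"
    by linarith
  then show ?thesis
  proof cases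
    case same
    then have "blow_up W (n + e) = entry (vtm b) (W ! (p + e))"
      using blow_up_block[of "p + e" W b] m n by (simp add: ac_simps)
    with same assms(1) n_eq show ?thesis
      by (simp add: mismatch_def separated_equalD flip: p_def)
  next
    case adjacent
    then have "n + e = Suc b * m + (p + e - m)" "p + e - m < m" using n by auto
    then have "blow_up W (n + e) = entry (vtm (Suc b)) (W ! (p + e - m))"
      using blow_up_block[of "p + e - m" W "Suc b"] m by simp
    with adjacent assms(1) n_eq vtm_Suc_neq[of b] vtm_range show ?thesis
      by (simp add: mismatch_def flip: p_def) (metis separated_distinctD vtm_range)
  next
    case far
    \<comment> \<open>Only the place inside the block matters now, so \<open>e\<close> may be
      reduced modulo \<open>m\<close>.\<close>
    have "(n + e) mod m = (p + e mod m) mod m"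
      unfolding p_def by (simp only: mod_simps)
    also have "\<dots> = (if p + e mod m < m then p + e mod m else p + e mod m - m)"
      using p m by (subst mod_step) simp_all
    finally have eq: "(n + e) mod m = (if p + e mod m < m then p + e mod m else p + e mod m - m)" .
    have "separated (W ! p) (W ! ((n + e) mod m))"
      using far assms(1) unfolding eq by (simp add: mismatch_def flip: p_def)
    then show ?thesis
      unfolding n_eq blow_up_def[of W "n + e"] m(1) [symmetric] by (intro separatedD vtm_range)
  qed
qed

text \<open>
  Walks \<open>n\<close> steps of the progression from residue \<open>p\<close> and fails after more than \<open>w\<close> consecutive
  residues without a mismatch (\<open>c\<close> of them are still tolerated). The conditionals in place of
  conjunctions and of \<open>mod\<close> keep the evaluation by rewriting short.
\<close>

primrec scan :: "column list \<Rightarrow> nat \<Rightarrow> nat \<Rightarrow> nat \<Rightarrow> nat \<Rightarrow> nat \<Rightarrow> nat \<Rightarrow> nat \<Rightarrow> nat \<Rightarrow> bool" where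
  "scan W m d e s w 0 p c \<longleftrightarrow> True"
| "scan W m d e s w (Suc n) p c \<longleftrightarrow>
     (if mismatch W m e s p then scan W m d e s w n (if p + d < m then p + d else p + d - m) w
      else if c = 0 then False
      else scan W m d e s w n (if p + d < m then p + d else p + d - m) (c - 1))"

text \<open>The second conjunct is the goal: every window of \<open>w + 1\<close> terms inside the
  scan has a mismatch. The first carries the induction through a window already begun, of which
  \<open>c + 1\<close> terms remain.\<close>

lemma scan_sound:
  assumes "scan W m d e s w n p c" "c \<le> w" "p < m" "d < m"
  shows "(c < n \<longrightarrow> (\<exists>j\<le>c. mismatch W m e s ((p + j * d) mod m))) \<and>
    (\<forall>i. i + w < n \<longrightarrow> (\<exists>j\<le>w. mismatch W m e s ((p + (i + j) * d) mod m)))"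
  using assms
proof (induction n arbitrary: p c)
  case (Suc n)
  let ?M = "mismatch W m e s"
  define p' where "p' = (p + d) mod m"
  have p': "p' < m" using Suc.prems by (simp add: p'_def)
  have shift: "(p' + j * d) mod m = (p + Suc j * d) mod m" for j
    by (simp add: p'_def mod_simps ac_simps)
  show ?case
  proof (cases "?M p")
    case True
    with Suc.prems have "scan W m d e s w n p' w" by (simp add: mod_step p'_def)
    note IH = Suc.IH[OF this order_refl p' \<open>d < m\<close>]
    have "\<exists>j\<le>w. ?M ((p + (i + j) * d) mod m)" if "i + w < Suc n" for i
    proof (cases i)
      case 0
      then show ?thesis using True \<open>p < m\<close> by (intro exI[of _ 0]) simp
    next
      case (Suc i')
      with IH that obtain j where "j \<le> w" "?M ((p' + (i' + j) * d) mod m)" by auto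
      then show ?thesis unfolding shift Suc by auto
    qed
    moreover have "?M ((p + 0 * d) mod m)" using True \<open>p < m\<close> by simp
    ultimately show ?thesis by blast
  next
    case False
    with Suc.prems have c: "c > 0" and "scan W m d e s w n p' (c - 1)"
      by (auto simp: mod_step p'_def split: if_splits)
    from Suc.IH[OF this(2) _ p' \<open>d < m\<close>] \<open>c \<le> w\<close>
    have IH1: "c - 1 < n \<Longrightarrow> \<exists>j\<le>c - 1. ?M ((p' + j * d) mod m)"
      and IH2: "\<And>i. i + w < n \<Longrightarrow> \<exists>j\<le>w. ?M ((p' + (i + j) * d) mod m)" by auto
    have first: "\<exists>j\<le>c. ?M ((p + j * d) mod m)" if "c < Suc n"
    proof -
      have "c - 1 < n" using that c by simp
      from IH1[OF this] obtain j where "j \<le> c - 1" "?M ((p' + j * d) mod m)" by auto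
      then show ?thesis unfolding shift using c by (intro exI[of _ "Suc j"]) auto
    qed
    have "\<exists>j\<le>w. ?M ((p + (i + j) * d) mod m)" if "i + w < Suc n" for i
    proof (cases i)
      case 0
      with that \<open>c \<le> w\<close> have "c < Suc n" by simp
      from first[OF this] \<open>c \<le> w\<close> 0 show ?thesis by (metis add_0 le_trans)
    next
      case (Suc i')
      with IH2 that obtain j where "j \<le> w" "?M ((p' + (i' + j) * d) mod m)" by auto
      then show ?thesis unfolding shift Suc by auto
    qed
    with first show ?thesis by blast
  qed
qed simp

text \<open>
  Scans the shifts \<open>e, e + d, e + 2 * d, \<dots>\<close>. Windows of \<open>t\<close> terms may be used for the shift
  \<open>t * d\<close>, but windows of 12 terms already suffice for the words below; the cap bounds the
  length of the scans.
\<close>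

primrec sweep :: "column list \<Rightarrow> nat \<Rightarrow> nat \<Rightarrow> nat \<Rightarrow> nat \<Rightarrow> nat \<Rightarrow> nat \<Rightarrow> bool" where
  "sweep W m d 0 e s w \<longleftrightarrow> True"
| "sweep W m d (Suc n) e s w \<longleftrightarrow>
     (if scan W m d e s w (m + w) 0 w
      then sweep W m d n (e + d) (if s + d < m then s + d else s + d - m) (if w < 11 then w + 1 else w)
      else False)"

text \<open>The cap can only shorten the windows tested, which is a stronger test, so the uncapped
  bound \<open>w + i\<close> survives the induction.\<close>

lemma sweep_sound:
  assumes "sweep W m d n e (e mod m) w" "d < m" "i < n" "r < m"
  shows "\<exists>j\<le>w + i. mismatch W m (e + i * d) ((e + i * d) mod m) (((r + j) * d) mod m)"
  using assms
proof (induction n arbitrary: e w i)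
  case (Suc n)
  show ?case
  proof (cases i)
    case 0
    \<comment> \<open>A scan of \<open>m + w\<close> steps gives each of the \<open>m\<close>
      starting indices a full window.\<close>
    from Suc.prems have "scan W m d e (e mod m) w (m + w) 0 w" by (auto split: if_splits)
    from scan_sound[OF this] Suc.prems 0 show ?thesis by fastforce
  next
    case (Suc i')
    let ?w = "if w < 11 then w + 1 else w"
    have "(if e mod m + d < m then e mod m + d else e mod m + d - m) = (e + d) mod m"
      using Suc.prems by (subst mod_step) (auto simp: mod_simps)
    with Suc.prems have "sweep W m d n (e + d) ((e + d) mod m) ?w"
      by (auto split: if_splits)
    from Suc.IH[OF this \<open>d < m\<close> _ \<open>r < m\<close>, of i'] Suc.prems Suc
    obtain j where "j \<le> ?w + i'"
      "mismatch W m (e + d + i' * d) ((e + d + i' * d) mod m) ((r + j) * d mod m)" by auto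
    with Suc show ?thesis by (intro exI[of _ j]) (auto simp: ac_simps split: if_splits)
  qed
qed simp

section \<open>Aligned halves: pivots reveal the square-free word\<close>

fun pivot :: "column \<Rightarrow> bool" where
  "pivot (a, b, c) \<longleftrightarrow> a \<noteq> b \<and> a \<noteq> c \<and> b \<noteq> c"

lemma pivotD:
  "pivot x \<Longrightarrow> entry z x = entry z' x \<Longrightarrow> z \<in> {-1, 0, 1} \<Longrightarrow> z' \<in> {-1, 0, 1} \<Longrightarrow> z = z'"
  by (cases x) (auto split: if_splits)

lemma arith_progression_hits_residue:
  fixes d m p i :: nat
  assumes "coprime d m" "p < m"
  shows "\<exists>j<m. (i + j * d) mod m = p"
proof -
  from assms(1) obtain x where x: "[d * x = 1] (mod m)"
    using cong_solve_coprime_nat by auto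
  \<comment> \<open>Modulo \<open>m\<close> this is \<open>p - i\<close>, written without truncated
    subtraction; \<open>x\<close> inverts \<open>d\<close>.\<close>
  define y where "y = p + (m - 1) * i"
  have "[i + x * y * d = i + 1 * y] (mod m)"
    using x by (intro cong_add cong_refl) (metis cong_scalar_right mult.assoc mult.commute)
  also have "i + 1 * y = p + m * i"
    using assms(2) by (cases m) (auto simp: y_def)
  also have "[p + m * i = p] (mod m)" by (simp add: cong_def)
  finally have "(i + x * y * d) mod m = p" using assms(2) by (simp add: cong_def)
  then have "(i + (x * y mod m) * d) mod m = p" by (metis mod_add_right_eq mod_mult_left_eq)
  with assms(2) show ?thesis by (intro exI[of _ "x * y mod m"]) auto
qed

text \<open>The halves lie \<open>P = u * d\<close> blocks apart. Each block has a pivot on the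
  progression, where equality of images forces equality of letters of \<open>vtm\<close>. This must
  be obtained for \<open>P\<close> consecutive blocks, although the first half may begin inside a
  block.\<close>

lemma blow_up_ap_square_free_dvd:
  assumes m: "m = length W" "m > 0" and "d > 0"
    and pivots: "\<And>c. c < d \<Longrightarrow> \<exists>p<m. p mod d = c \<and> pivot (W ! p)"
    and "t > 0" "m dvd t"
  shows "\<exists>j<t. blow_up W (i + j * d) \<noteq> blow_up W (i + j * d + t * d)"
proof (rule ccontr)
  assume contra: "\<not> ?thesis"
  from \<open>m dvd t\<close> obtain u where u: "t = m * u" by blast
  define P where "P = u * d"
  have P: "P > 0" and td: "t * d = P * m" using \<open>t > 0\<close> \<open>d > 0\<close> u by (simp_all add: P_def)
  have period: "blow_up W n = blow_up W (n + P * m)"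
    if n: "i \<le> n" "n < i + P * m" "n mod d = i mod d" for n
  proof -
    from n(3,1) obtain j where j: "n = i + d * j" by (rule mod_eq_nat1E)
    with n td have "j * d < t * d" by (simp add: mult.commute)
    then have "j < t" by simp
    with contra have "blow_up W (i + j * d) = blow_up W (i + j * d + t * d)" by blast
    with j td show ?thesis by (simp add: mult.commute)
  qed
  have pivot_in_block: "\<exists>p<m. (b * m + p) mod d = i mod d \<and> pivot (W ! p)" for b
  proof -
    \<comment> \<open>Modulo \<open>d\<close> the requested class is
      \<open>i - b * m\<close>.\<close>
    from pivots[of "(i + (d - 1) * (b * m)) mod d"] \<open>d > 0\<close> obtain p
      where p: "p < m" "p mod d = (i + (d - 1) * (b * m)) mod d" "pivot (W ! p)" by auto
    have "(b * m + p) mod d = (b * m + (i + (d - 1) * (b * m))) mod d"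
      using p(2) by (metis mod_add_right_eq)
    also have "b * m + (i + (d - 1) * (b * m)) = i + d * (b * m)"
      using \<open>d > 0\<close> by (cases d) auto
    finally show ?thesis using p by auto
  qed
  define b0 where "b0 = i div m"
  have b0: "b0 * m \<le> i" "i < Suc b0 * m"
    using m(2) by (simp_all add: b0_def dividend_less_div_times)
  from pivot_in_block[of b0] obtain p0
    where p0: "p0 < m" "(b0 * m + p0) mod d = i mod d" "pivot (W ! p0)" by blast
  have same_letter: "vtm b = vtm (b + P)"
    if "p < m" "pivot (W ! p)" "(b * m + p) mod d = i mod d"
      "i \<le> b * m + p" "b * m + p < i + P * m" for b p
  proof -
    have "blow_up W (b * m + p) = blow_up W ((b + P) * m + p)"
      using period[of "b * m + p"] that by (simp add: algebra_simps)
    then have "entry (vtm b) (W ! p) = entry (vtm (b + P)) (W ! p)"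
      using that(1) m(1) by (simp add: blow_up_block)
    with that(2) show ?thesis by (intro pivotD vtm_range)
  qed
  have inner: "vtm b = vtm (b + P)" if b: "b0 < b" "b < b0 + P" for b
  proof -
    from pivot_in_block[of b] obtain p
      where p: "p < m" "(b * m + p) mod d = i mod d" "pivot (W ! p)" by blast
    have "Suc b0 * m \<le> b * m" using b(1) by (intro mult_le_mono1) simp
    moreover have "Suc b * m \<le> (b0 + P) * m" using b(2) by (intro mult_le_mono1) simp
    ultimately have "i \<le> b * m + p" "b * m + p < i + P * m"
      using b0 p(1) by (auto simp: algebra_simps)
    with p show ?thesis by (intro same_letter)
  qed
  have "m \<le> P * m" using P by simp
  show False
  \<comment> \<open>The inner blocks supply \<open>P - 1\<close> equalities. The missing one comes
    from block \<open>b0\<close> if its pivot is not before \<open>i\<close>, and otherwise from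
    block \<open>b0 + P\<close>, which gives a square starting one block later.\<close>
  proof (cases "i \<le> b0 * m + p0")
    case True
    have "b0 * m + p0 < i + P * m" using p0(1) b0 \<open>m \<le> P * m\<close> by linarith
    from same_letter[OF p0(1,3,2) True this] have "vtm b0 = vtm (b0 + P)" .
    with inner have "vtm (b0 + j) = vtm (b0 + P + j)" if "j < P" for j
      using that by (cases j) (auto simp: ac_simps)
    with vtm_square_free[OF P, of b0] show False by blast
  next
    case False
    \<comment> \<open>The same pivot \<open>p0\<close> serves block \<open>b0 + P\<close>, since
      \<open>P * m\<close> is a multiple of \<open>d\<close>.\<close>
    have "((b0 + P) * m + p0) mod d = (b0 * m + p0 + d * (u * m)) mod d"
      by (simp add: P_def algebra_simps)
    with p0(2) have "((b0 + P) * m + p0) mod d = i mod d" by simp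
    moreover have "i \<le> (b0 + P) * m + p0" "(b0 + P) * m + p0 < i + P * m"
      using False b0 \<open>m \<le> P * m\<close> by (simp_all only: add_mult_distrib mult_Suc)
    ultimately have last: "vtm (b0 + P) = vtm (b0 + P + P)" using p0 by (intro same_letter)
    have "vtm (Suc b0 + j) = vtm (Suc b0 + P + j)" if "j < P" for j
    proof (cases "Suc j = P")
      case True
      then have eqs: "Suc b0 + j = b0 + P" "Suc b0 + P + j = b0 + P + P" by auto
      show ?thesis unfolding eqs by (rule last)
    next
      case False
      with that inner[of "Suc b0 + j"] show ?thesis by (simp add: ac_simps)
    qed
    with vtm_square_free[OF P, of "Suc b0"] show False by blast
  qed
qed

text \<open>
  The shifts \<open>2 * m + s\<close> with \<open>s < m\<close> relate non-adjacent blocks only, so the sweep over them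
  covers, for every \<open>d\<close>, all \<open>t \<ge> m\<close> that \<open>m\<close> does not divide: a progression of \<open>m\<close> terms
  meets every residue.
\<close>

definition certificate :: "nat \<Rightarrow> nat \<Rightarrow> nat list \<Rightarrow> column list \<Rightarrow> bool" where
  "certificate k m ps W \<longleftrightarrow>
     length W = m \<and> k < m \<and>
     (\<forall>(a, b, c)\<in>set W. a < k + 2 \<and> b < k + 2 \<and> c < k + 2) \<and>
     (\<forall>p\<in>set ps. p < m \<and> pivot (W ! p)) \<and>
     sweep W m 1 (m - 1) (2 * m + 1) 1 11 \<and>
     (\<forall>d\<in>{1..k}. coprime d m \<and> (\<forall>c<d. \<exists>p\<in>set ps. p mod d = c) \<and> sweep W m d (m - 1) d d 0)"

lemma blow_up_ap_square_free:
  assumes cert: "certificate k m ps W" and d: "1 \<le> d" "d \<le> k" and "t > 0"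
  shows "\<exists>j<t. blow_up W (i + j * d) \<noteq> blow_up W (i + j * d + t * d)"
proof -
  have m: "m = length W" and "k < m"
    and ps: "\<forall>p\<in>set ps. p < m \<and> pivot (W ! p)"
    and far: "sweep W m 1 (m - 1) (2 * m + 1) 1 11"
    and "\<forall>d\<in>{1..k}. coprime d m \<and> (\<forall>c<d. \<exists>p\<in>set ps. p mod d = c) \<and>
      sweep W m d (m - 1) d d 0"
    using cert unfolding certificate_def by blast+
  moreover from d have "d \<in> {1..k}" by simp
  ultimately have coprime: "coprime d m" and near: "sweep W m d (m - 1) d d 0"
    and classes: "\<forall>c<d. \<exists>p\<in>set ps. p mod d = c" by blast+
  from \<open>k < m\<close> d have "m > 1" "d < m" by simp_all
  note m = m this
  have pivots: "\<exists>p<m. p mod d = c \<and> pivot (W ! p)" if "c < d" for c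
    using classes ps that by blast
  consider "m dvd t" | (small) "\<not> m dvd t" "t < m" | (large) "\<not> m dvd t" "t \<ge> m" by linarith
  then show ?thesis
  proof cases
    case 1
    with m d pivots \<open>t > 0\<close> show ?thesis by (intro blow_up_ap_square_free_dvd) auto
  next
    case small
    \<comment> \<open>The sweep walks the multiples of \<open>d\<close> modulo \<open>m\<close>, so
      the start \<open>i\<close> must be located among them.\<close>
    have "i mod m < m" using \<open>m > 1\<close> by simp
    from arith_progression_hits_residue[OF coprime this, of 0] obtain r
      where r: "r < m" "(r * d) mod m = i mod m" by auto
    have "d + (t - 1) * d = t * d" using \<open>t > 0\<close> by (cases t) auto
    moreover have "d mod m = d" "t - 1 < m - 1" using small \<open>d < m\<close> \<open>t > 0\<close> by simp_all
    ultimately obtain j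
      where j: "j \<le> t - 1" "mismatch W m (t * d) ((t * d) mod m) ((r + j) * d mod m)"
      using sweep_sound[of W m d "m - 1" d 0 "t - 1" r] near \<open>d < m\<close> r(1) by auto
    have "(r + j) * d mod m = (i + j * d) mod m"
      using r(2) by (metis add_mult_distrib mod_add_left_eq)
    with j have "mismatch W m (t * d) ((t * d) mod m) ((i + j * d) mod m)" by simp
    from mismatchD[OF this m(1)] \<open>m > 1\<close>
    have "blow_up W (i + j * d) \<noteq> blow_up W (i + j * d + t * d)" by simp
    with j(1) \<open>t > 0\<close> show ?thesis by (intro exI[of _ j]) auto
  next
    case large
    define s where "s = (t * d) mod m"
    have "s < m" using \<open>m > 1\<close> by (simp add: s_def)
    have "s > 0" using large(1) coprime unfolding s_def
      by (metis coprime_commute coprime_dvd_mult_left_iff mod_greater_zero_iff_not_dvd)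
    have "2 * m + 1 + (s - 1) * 1 = 2 * m + s" using \<open>s > 0\<close> by simp
    moreover have "s - 1 < m - 1" using \<open>s < m\<close> \<open>s > 0\<close> by linarith
    moreover have "(2 * m + s) mod m = s" "(2 * m + 1) mod m = 1"
      using \<open>s < m\<close> \<open>m > 1\<close> by (simp_all only: mod_mult_self3 mod_less)
    ultimately obtain j where "mismatch W m (2 * m + s) s (j mod m)"
      using sweep_sound[of W m 1 "m - 1" "2 * m + 1" 11 "s - 1" 0] far \<open>m > 1\<close> \<open>s < m\<close> \<open>s > 0\<close>
      by auto
    moreover define p where "p = j mod m"
    moreover have "p < m" using \<open>m > 1\<close> by (simp add: p_def)
    \<comment> \<open>A shift of at least \<open>2 * m\<close> excludes the first two branches of
      \<open>mismatch\<close>.\<close>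
    ultimately have sep: "separated (W ! p) (W ! ((p + s) mod m))"
      using \<open>s < m\<close> mod_step[of p m s] by (simp add: mismatch_def split: if_splits)
    \<comment> \<open>The one separated pair is met within \<open>m\<close> terms, hence within
      \<open>t\<close> terms.\<close>
    obtain j where j: "j < m" "(i + j * d) mod m = p"
      using arith_progression_hits_residue[OF coprime \<open>p < m\<close>, of i] by blast
    then have "(i + j * d + t * d) mod m = (p + s) mod m"
      unfolding s_def by (metis mod_add_eq mod_mod_trivial)
    with j sep m(1) have "blow_up W (i + j * d) \<noteq> blow_up W (i + j * d + t * d)"
      unfolding blow_up_def by (metis separatedD vtm_range)
    with j(1) large(2) show ?thesis by (intro exI[of _ j]) auto
  qed
qed

section \<open>From words on the naturals to k-Thue lists\<close>

lemma nths_arith_progression: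
  assumes "d > 0"
  shows "\<exists>N. nths (map f [0..<n]) {i + j * d |j. True} = map (\<lambda>j. f (i + j * d)) [0..<N] \<and>
    (\<forall>j. i + j * d < n \<longleftrightarrow> j < N)"
proof (induction n)
  case (Suc n)
  then obtain N where N: "nths (map f [0..<n]) {i + j * d |j. True} = map (\<lambda>j. f (i + j * d)) [0..<N]"
    and less: "\<And>j. i + j * d < n \<longleftrightarrow> j < N" by blast
  show ?case
  proof (cases "\<exists>j. n = i + j * d")
    case True
    then obtain j where j: "n = i + j * d" by blast
    \<comment> \<open>The second conjunct of the induction hypothesis identifies a newly reached
      term as the one of index \<open>N\<close>.\<close>
    have "j = N"
    proof (rule antisym)
      show "N \<le> j" using less[of j] j by simp
      show "j \<le> N" using less[of N] j assms by (simp add: not_less)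
    qed
    with j have n: "n = i + N * d" by simp
    have "i + j * d < Suc n \<longleftrightarrow> j < Suc N" for j
      using n assms by (auto simp: less_Suc_eq_le)
    moreover have "nths (map f [0..<Suc n]) {i + j * d |j. True} = map (\<lambda>j. f (i + j * d)) [0..<Suc N]"
      using N n by (auto simp: nths_append)
    ultimately show ?thesis by blast
  next
    case False
    have "i + j * d < Suc n \<longleftrightarrow> j < N" for j
      using False less[of j] by (metis less_Suc_eq)
    moreover have "nths (map f [0..<Suc n]) {i + j * d |j. True} = map (\<lambda>j. f (i + j * d)) [0..<N]"
      using N False by (auto simp: nths_append)
    ultimately show ?thesis by blast
  qed
qed auto

lemma k_thue_if_no_ap_square:
  assumes "\<And>d i t. 1 \<le> d \<Longrightarrow> d \<le> k \<Longrightarrow> t > 0 \<Longrightarrow> \<exists>j<t. f (i + j * d) \<noteq> f (i + j * d + t * d)"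
  shows "k_thue k (map f [0..<n])"
  unfolding k_thue_def thue_def
proof (intro allI impI notI, elim conjE exE)
  fix d i ys
  assume d: "1 \<le> d" "d \<le> k" and ys: "sublist ys (d_subsequence d i (map f [0..<n]))" "repetition ys"
  from nths_arith_progression[of d f n i] d(1) obtain N
    where N: "d_subsequence d i (map f [0..<n]) = map (\<lambda>j. f (i + j * d)) [0..<N]"
    unfolding d_subsequence_def by auto
  from ys(1) obtain as bs where split: "map (\<lambda>j. f (i + j * d)) [0..<N] = as @ ys @ bs"
    unfolding N sublist_def by blast
  have ys_nth: "ys ! l = f (i + (length as + l) * d)" if "l < length ys" for l
  proof -
    have "length as + l < N" using arg_cong[OF split, of length] that by simp
    then have "f (i + (length as + l) * d) = (as @ ys @ bs) ! (length as + l)"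
      unfolding split [symmetric] by simp
    also have "\<dots> = ys ! l" using that by (simp add: nth_append)
    finally show ?thesis ..
  qed
  from ys(2) obtain t where t: "t \<ge> 1" "length ys = 2 * t" "\<And>l. l < t \<Longrightarrow> ys ! l = ys ! (t + l)"
    unfolding repetition_def by blast
  have "f (i + length as * d + j * d) = f (i + length as * d + j * d + t * d)" if "j < t" for j
    using t(2) t(3)[OF that] ys_nth[of j] ys_nth[of "t + j"] that by (simp add: algebra_simps)
  with assms[OF d, of t "i + length as * d"] t(1) show False by force
qed

lemma k_thue_if_certificate:
  fixes A :: "'a set"
  assumes cert: "certificate k m ps W" and A: "finite A" "card A = k + 2"
  shows "\<exists>xs :: 'a list. length xs = n \<and> set xs \<subseteq> A \<and> k_thue k xs"
proof -
  from A obtain g where g: "bij_betw g {0..<k + 2} A" using ex_bij_betw_nat_finite by metis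
  have "W \<noteq> []" and entries: "\<forall>(a, b, c)\<in>set W. a < k + 2 \<and> b < k + 2 \<and> c < k + 2"
    using cert by (auto simp: certificate_def)
  have range: "blow_up W l \<in> {0..<k + 2}" for l
  proof -
    obtain a b c where abc: "W ! (l mod length W) = (a, b, c)" by (metis prod_cases3)
    have "W ! (l mod length W) \<in> set W" using \<open>W \<noteq> []\<close> by simp
    with entries abc show ?thesis by (auto simp: blow_up_def)
  qed
  have "k_thue k (map (g \<circ> blow_up W) [0..<n])"
  proof (rule k_thue_if_no_ap_square)
    fix d i t :: nat
    assume "1 \<le> d" "d \<le> k" "t > 0"
    from blow_up_ap_square_free[OF cert this] range
    show "\<exists>j<t. (g \<circ> blow_up W) (i + j * d) \<noteq> (g \<circ> blow_up W) (i + j * d + t * d)"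
      using bij_betw_imp_inj_on[OF g] by (metis comp_apply inj_on_eq_iff)
  qed
  moreover have "set (map (g \<circ> blow_up W) [0..<n]) \<subseteq> A"
    using range bij_betw_imp_surj_on[OF g] by fastforce
  ultimately show ?thesis by (intro exI[of _ "map (g \<circ> blow_up W) [0..<n]"]) simp
qed

subsection \<open>The morphisms\<close>

text \<open>The arguments are the block words of the letters -1, 0 and 1, in this order.\<close>

definition columns :: "nat list \<Rightarrow> nat list \<Rightarrow> nat list \<Rightarrow> column list" where
  "columns u v w = zip u (zip v w)"

text \<open>For an explicit list this simplifies to one rewrite rule per position, so a lookup does
  not traverse the list.\<close>

lemma nth_table: "xs = ys \<Longrightarrow> list_all (\<lambda>(n, y). xs ! n = y) (enumerate 0 ys)"
  by (auto simp: list_all_iff in_set_enumerate_eq)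

lemmas nth_table_simps =
  columns_def zip_Cons_Cons zip.simps(1) enumerate_simps list.pred_inject prod.case simp_thms
  One_nat_def [symmetric] Suc_1 Suc_numeral add_num_simps

text \<open>Peels off one step while the counter stays a binary numeral instead of a tower of
  \<open>Suc\<close>.\<close>

lemma scan_numeral:
  "scan W m d e s w (numeral n) p c \<longleftrightarrow>
     (if mismatch W m e s p
      then scan W m d e s w (pred_numeral n) (if p + d < m then p + d else p + d - m) w
      else if c = 0 then False
      else scan W m d e s w (pred_numeral n) (if p + d < m then p + d else p + d - m) (c - 1))"
  by (simp only: numeral_eq_Suc [of n] scan.simps)

lemma scan_one:
  "scan W m d e s w 1 p c \<longleftrightarrow> (if mismatch W m e s p then True else if c = 0 then False else True)"
  by simp

lemma sweep_numeral:
  "sweep W m d (numeral n) e s w \<longleftrightarrow>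
     (if scan W m d e s w (m + w) 0 w
      then sweep W m d (pred_numeral n) (e + d) (if s + d < m then s + d else s + d - m)
        (if w < 11 then w + 1 else w)
      else False)"
  by (simp only: numeral_eq_Suc [of n] sweep.simps)

lemma sweep_one: "sweep W m d 1 e s w \<longleftrightarrow> scan W m d e s w (m + w) 0 w"
  by simp

lemmas evaluation =
  sweep_numeral sweep_one scan_numeral scan_one mismatch_def
  separated_def separated_equal.simps separated_distinct.simps
  if_True if_False simp_thms pred_numeral_simps pred_numeral_def [symmetric]
  arith_simps rel_simps add_0_left add_0_right numeral_One one_plus_numeral numeral_plus_one
  one_add_one diff_nat_numeral diff_self_eq_0 nat_numeral nat_0 nat_one_as_int [symmetric]
  diff_numeral_special zero_neq_one one_neq_zero zero_less_one mult_numeral_1_right mult_numeral_1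

definition columns4 :: "column list" where
  "columns4 = columns
    [4, 5, 2, 3, 0, 4, 1, 2, 5, 0, 4, 1, 2, 3, 5, 4, 1, 2, 0, 5, 4, 3, 2, 1, 0]
    [4, 5, 2, 3, 1, 0, 4, 2, 5, 1, 0, 3, 2, 4, 5, 1, 3, 2, 0, 5, 4, 3, 2, 1, 0]
    [4, 5, 2, 1, 3, 4, 0, 2, 5, 3, 1, 0, 2, 4, 5, 1, 3, 2, 0, 5, 4, 3, 2, 1, 0]"

lemmas columns4_nth =
  nth_table [OF columns4_def, simplified nth_table_simps]

text \<open>The listed pivots meet every residue class modulo each \<open>d \<le> 4\<close>. The
  block length 25, like 49 and 59 below, is a power of a prime exceeding \<open>k\<close>, hence
  coprime to every \<open>d \<le> k\<close>.\<close>

lemma certificate4: "certificate 4 25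
  [4, 9, 10, 11] columns4"
  unfolding certificate_def
proof (intro conjI)
  show "length columns4 = 25" "4 < (25 :: nat)"
    by (simp_all add: columns4_def columns_def)
  show "\<forall>(a, b, c)\<in>set columns4. a < 4 + 2 \<and> b < 4 + 2 \<and> c < 4 + 2"
    by (simp add: columns4_def columns_def)
  show "\<forall>p\<in>set [4, 9, 10, 11]. p < 25 \<and> pivot (columns4 ! p)"
    by (simp add: columns4_nth)
  \<comment> \<open>With \<open>if_weak_cong\<close> a branch is rewritten only after its condition
    is decided, so only the path taken is evaluated.\<close>
  show "sweep columns4 25 1 (25 - 1) (2 * 25 + 1) 1 11"
    by (simp only: evaluation columns4_nth cong: if_weak_cong)
  have range: "{1..4 :: nat} = {1, 2, 3, 4}" by auto
  have "\<forall>d\<in>{1..4 :: nat}. coprime d 25 \<and>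
      (\<forall>c<d. \<exists>p\<in>set [4, 9, 10, 11]. p mod d = c)"
    by code_simp
  moreover have "\<forall>d\<in>{1..4}. sweep columns4 25 d (25 - 1) d d 0"
    unfolding range by (simp only: ball_simps evaluation columns4_nth cong: if_weak_cong)
  ultimately show "\<forall>d\<in>{1..4}. coprime d 25 \<and>
      (\<forall>c<d. \<exists>p\<in>set [4, 9, 10, 11]. p mod d = c) \<and>
      sweep columns4 25 d (25 - 1) d d 0" by blast
qed

definition columns5 :: "column list" where
  "columns5 = columns
    [6, 4, 3, 5, 2, 1, 0, 6, 4, 5, 3, 2, 1, 0, 4, 6, 5, 3, 2, 1, 0, 4, 5, 6, 3, 2, 1, 0, 5, 6,
     4, 3, 2, 1, 0, 5, 6, 3, 4, 2, 1, 0, 6, 5, 4, 3, 2, 1, 0]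
    [6, 5, 3, 2, 4, 1, 0, 6, 3, 5, 2, 4, 1, 0, 3, 6, 5, 2, 4, 1, 0, 3, 5, 6, 4, 2, 1, 0, 5, 6,
     4, 3, 2, 1, 0, 5, 6, 3, 4, 2, 1, 0, 6, 5, 4, 3, 2, 1, 0]
    [6, 4, 3, 2, 5, 1, 0, 6, 4, 2, 5, 3, 1, 0, 4, 2, 5, 6, 3, 1, 0, 4, 5, 6, 3, 2, 1, 0, 5, 6,
     4, 3, 2, 1, 0, 5, 6, 3, 4, 2, 1, 0, 6, 5, 4, 3, 2, 1, 0]"

lemmas columns5_nth =
  nth_table [OF columns5_def, simplified nth_table_simps]

lemma certificate5: "certificate 5 49
  [4, 10, 11, 17, 18] columns5"
  unfolding certificate_def
proof (intro conjI)
  show "length columns5 = 49" "5 < (49 :: nat)"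
    by (simp_all add: columns5_def columns_def)
  show "\<forall>(a, b, c)\<in>set columns5. a < 5 + 2 \<and> b < 5 + 2 \<and> c < 5 + 2"
    by (simp add: columns5_def columns_def)
  show "\<forall>p\<in>set [4, 10, 11, 17, 18]. p < 49 \<and> pivot (columns5 ! p)"
    by (simp add: columns5_nth)
  show "sweep columns5 49 1 (49 - 1) (2 * 49 + 1) 1 11"
    by (simp only: evaluation columns5_nth cong: if_weak_cong)
  have range: "{1..5 :: nat} = {1, 2, 3, 4, 5}" by auto
  have "\<forall>d\<in>{1..5 :: nat}. coprime d 49 \<and>
      (\<forall>c<d. \<exists>p\<in>set [4, 10, 11, 17, 18]. p mod d = c)"
    by code_simp
  moreover have "\<forall>d\<in>{1..5}. sweep columns5 49 d (49 - 1) d d 0"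
    unfolding range by (simp only: ball_simps evaluation columns5_nth cong: if_weak_cong)
  ultimately show "\<forall>d\<in>{1..5}. coprime d 49 \<and>
      (\<forall>c<d. \<exists>p\<in>set [4, 10, 11, 17, 18]. p mod d = c) \<and>
      sweep columns5 49 d (49 - 1) d d 0" by blast
qed

definition columns6 :: "column list" where
  "columns6 = columns
    [7, 5, 4, 6, 2, 3, 1, 7, 5, 4, 6, 0, 2, 1, 7, 3, 4, 6, 0, 5, 1, 7, 3, 4, 6, 2, 0, 1, 5, 3,
     4, 6, 2, 7, 0, 5, 1, 4, 3, 2, 7, 0, 6, 5, 4, 3, 2, 1, 0]
    [6, 5, 7, 3, 2, 4, 1, 6, 5, 7, 0, 2, 3, 1, 6, 4, 7, 0, 2, 5, 1, 6, 3, 4, 7, 2, 0, 1, 5, 3,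
     4, 6, 2, 7, 0, 5, 1, 4, 3, 2, 7, 0, 6, 5, 4, 3, 2, 1, 0]
    [6, 5, 4, 7, 2, 3, 1, 0, 5, 4, 7, 2, 6, 1, 3, 0, 4, 7, 2, 5, 1, 3, 6, 4, 7, 2, 0, 1, 5, 3,
     4, 6, 2, 7, 0, 5, 1, 4, 3, 2, 7, 0, 6, 5, 4, 3, 2, 1, 0]"

lemmas columns6_nth =
  nth_table [OF columns6_def, simplified nth_table_simps]

lemma certificate6: "certificate 6 49
  [3, 7, 10, 12, 14, 17, 21] columns6"
  unfolding certificate_def
proof (intro conjI)
  show "length columns6 = 49" "6 < (49 :: nat)"
    by (simp_all add: columns6_def columns_def)
  show "\<forall>(a, b, c)\<in>set columns6. a < 6 + 2 \<and> b < 6 + 2 \<and> c < 6 + 2"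
    by (simp add: columns6_def columns_def)
  show "\<forall>p\<in>set [3, 7, 10, 12, 14, 17, 21]. p < 49 \<and> pivot (columns6 ! p)"
    by (simp add: columns6_nth)
  show "sweep columns6 49 1 (49 - 1) (2 * 49 + 1) 1 11"
    by (simp only: evaluation columns6_nth cong: if_weak_cong)
  have range: "{1..6 :: nat} = {1, 2, 3, 4, 5, 6}" by auto
  have "\<forall>d\<in>{1..6 :: nat}. coprime d 49 \<and>
      (\<forall>c<d. \<exists>p\<in>set [3, 7, 10, 12, 14, 17, 21]. p mod d = c)"
    by code_simp
  moreover have "\<forall>d\<in>{1..6}. sweep columns6 49 d (49 - 1) d d 0"
    unfolding range by (simp only: ball_simps evaluation columns6_nth cong: if_weak_cong)
  ultimately show "\<forall>d\<in>{1..6}. coprime d 49 \<and>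
      (\<forall>c<d. \<exists>p\<in>set [3, 7, 10, 12, 14, 17, 21]. p mod d = c) \<and>
      sweep columns6 49 d (49 - 1) d d 0" by blast
qed

definition columns7 :: "column list" where
  "columns7 = columns
    [7, 6, 5, 4, 8, 3, 2, 1, 0, 6, 5, 4, 8, 7, 3, 2, 1, 6, 5, 0, 4, 8, 7, 2, 1, 6, 3, 5, 0, 4,
     7, 2, 1, 8, 6, 3, 5, 0, 4, 2, 1, 8, 7, 6, 3, 5, 4, 2, 1, 0, 8, 7, 6, 5, 4, 3, 2, 1, 0]
    [7, 8, 5, 4, 6, 3, 2, 1, 0, 8, 5, 7, 6, 4, 3, 2, 1, 8, 5, 0, 7, 6, 4, 2, 1, 8, 3, 5, 0, 7,
     4, 2, 1, 8, 6, 3, 5, 0, 4, 2, 1, 8, 7, 6, 3, 5, 4, 2, 1, 0, 8, 7, 6, 5, 4, 3, 2, 1, 0]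
    [7, 6, 5, 8, 4, 3, 2, 1, 0, 7, 5, 8, 4, 6, 3, 2, 1, 7, 5, 0, 8, 4, 6, 2, 1, 7, 3, 5, 0, 8,
     4, 2, 1, 7, 6, 3, 5, 0, 4, 2, 1, 8, 7, 6, 3, 5, 4, 2, 1, 0, 8, 7, 6, 5, 4, 3, 2, 1, 0]"

lemmas columns7_nth =
  nth_table [OF columns7_def, simplified nth_table_simps]

lemma certificate7: "certificate 7 59
  [9, 11, 12, 13, 17, 20, 21, 22] columns7"
  unfolding certificate_def
proof (intro conjI)
  show "length columns7 = 59" "7 < (59 :: nat)"
    by (simp_all add: columns7_def columns_def)
  show "\<forall>(a, b, c)\<in>set columns7. a < 7 + 2 \<and> b < 7 + 2 \<and> c < 7 + 2"
    by (simp add: columns7_def columns_def)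
  show "\<forall>p\<in>set [9, 11, 12, 13, 17, 20, 21, 22]. p < 59 \<and> pivot (columns7 ! p)"
    by (simp add: columns7_nth)
  show "sweep columns7 59 1 (59 - 1) (2 * 59 + 1) 1 11"
    by (simp only: evaluation columns7_nth cong: if_weak_cong)
  have range: "{1..7 :: nat} = {1, 2, 3, 4, 5, 6, 7}" by auto
  have "\<forall>d\<in>{1..7 :: nat}. coprime d 59 \<and>
      (\<forall>c<d. \<exists>p\<in>set [9, 11, 12, 13, 17, 20, 21, 22]. p mod d = c)"
    by code_simp
  moreover have "\<forall>d\<in>{1..7}. sweep columns7 59 d (59 - 1) d d 0"
    unfolding range by (simp only: ball_simps evaluation columns7_nth cong: if_weak_cong)
  ultimately show "\<forall>d\<in>{1..7}. coprime d 59 \<and>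
      (\<forall>c<d. \<exists>p\<in>set [9, 11, 12, 13, 17, 20, 21, 22]. p mod d = c) \<and>
      sweep columns7 59 d (59 - 1) d d 0" by blast
qed

definition columns8 :: "column list" where
  "columns8 = columns
    [9, 7, 6, 8, 4, 5, 3, 2, 1, 9, 7, 6, 0, 4, 5, 8, 3, 2, 9, 1, 6, 0, 7, 4, 5, 3, 8, 2, 1, 9,
     0, 6, 4, 7, 3, 5, 2, 1, 8, 9, 0, 4, 7, 6, 5, 3, 2, 1, 9, 0, 8, 7, 6, 5, 4, 3, 2, 1, 0]
    [9, 7, 6, 5, 8, 4, 3, 2, 1, 9, 7, 6, 0, 8, 4, 5, 3, 2, 9, 1, 6, 0, 7, 8, 4, 3, 5, 2, 1, 9,
     0, 6, 8, 7, 3, 4, 2, 1, 5, 9, 0, 8, 7, 6, 4, 3, 2, 1, 9, 0, 8, 7, 6, 5, 4, 3, 2, 1, 0]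
    [8, 7, 6, 9, 5, 4, 3, 2, 1, 8, 7, 6, 0, 5, 9, 4, 3, 2, 8, 1, 6, 0, 7, 5, 9, 3, 4, 2, 1, 8,
     0, 6, 5, 7, 3, 4, 2, 1, 9, 8, 0, 5, 7, 6, 4, 3, 2, 1, 9, 0, 8, 7, 6, 5, 4, 3, 2, 1, 0]"

lemmas columns8_nth =
  nth_table [OF columns8_def, simplified nth_table_simps]

lemma certificate8: "certificate 8 59
  [3, 4, 13, 14, 15, 23, 24, 26, 32, 41] columns8"
  unfolding certificate_def
proof (intro conjI)
  show "length columns8 = 59" "8 < (59 :: nat)"
    by (simp_all add: columns8_def columns_def)
  show "\<forall>(a, b, c)\<in>set columns8. a < 8 + 2 \<and> b < 8 + 2 \<and> c < 8 + 2"
    by (simp add: columns8_def columns_def)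
  show "\<forall>p\<in>set [3, 4, 13, 14, 15, 23, 24, 26, 32, 41]. p < 59 \<and> pivot (columns8 ! p)"
    by (simp add: columns8_nth)
  show "sweep columns8 59 1 (59 - 1) (2 * 59 + 1) 1 11"
    by (simp only: evaluation columns8_nth cong: if_weak_cong)
  have range: "{1..8 :: nat} = {1, 2, 3, 4, 5, 6, 7, 8}" by auto
  have "\<forall>d\<in>{1..8 :: nat}. coprime d 59 \<and>
      (\<forall>c<d. \<exists>p\<in>set [3, 4, 13, 14, 15, 23, 24, 26, 32, 41]. p mod d = c)"
    by code_simp
  moreover have "\<forall>d\<in>{1..8}. sweep columns8 59 d (59 - 1) d d 0"
    unfolding range by (simp only: ball_simps evaluation columns8_nth cong: if_weak_cong)
  ultimately show "\<forall>d\<in>{1..8}. coprime d 59 \<and>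
      (\<forall>c<d. \<exists>p\<in>set [3, 4, 13, 14, 15, 23, 24, 26, 32, 41]. p mod d = c) \<and>
      sweep columns8 59 d (59 - 1) d d 0" by blast
qed

theorem theorem2:
  fixes k n :: nat and A :: "'a set"
  assumes "k \<in> {4, 5, 6, 7, 8}"
    and "finite A" and "card A = k + 2"
    and "n \<ge> 1"
  shows "\<exists>xs :: 'a list. length xs = n \<and> set xs \<subseteq> A \<and> k_thue k xs"
proof -
  from assms(1) obtain m ps W where "certificate k m ps W"
    using certificate4 certificate5 certificate6 certificate7 certificate8
    by (elim insertE emptyE) blast+
  from k_thue_if_certificate[OF this assms(2,3)] show ?thesis .
qed

end
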